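(* Let $\Pi$ be a finite and satisfiable set of constraints over the variables $x_1,\dots,x_D$. For any sample $\tilde{x}\in\mathbb{R}^D$ and any variable ordering, the corresponding sample $\mathrm{DRL}(\tilde{x})$ satisfies $\Pi$.
   Context: Constraints. Fix variables $x_1,\dots,x_D$ ranging over $\mathbb{R}$. A linear inequality is an expression $\sum_k w_k x_k + b\ge 0$ with $w_k,b\in\mathbb{R}$; $x_i$ occurs positively in it if $w_i>0$, negatively if $w_i<0$, and does not occur in it if $w_i=0$. When writing an inequality as $w_ix_i+\varphi\ge 0$ it is understood that $w_i\ne 0$ and that $\varphi=\sum_{k\neq i}w_kx_k+b$ does not contain $x_i$. A constraint $\Psi$ is a finite disjunction of linear inequalities (also viewed as the finite set of its disjuncts). A sample is a vector $\tilde x\in\mathbb{R}^D$ (assigning $\tilde x_k$ to $x_k$). A sample satisfies a constraint if it satisfies at least one of its linear inequalities, and satisfies a set $\Pi$ of constraints if it satisfies every constraint in $\Pi$. $\Omega(\Pi)$ is the set of points satisfying $\Pi$; $\Pi$ is satisfiable if $\Omega(\Pi)\neq\emptyset$. Variable ordering. A variable ordering is a total ordering of the variables; after renaming the variables, assume it is $x_1;x_2;\dots;x_D$. All the following definitions are relative to this ordering. CP resolution. Let $\Psi=\bigvee_{k=1}^n(w_kx_i+\varphi_k\ge0)\vee\Phi$ and $\Psi'=\bigvee_{j=1}^m(w'_jx_i+\varphi'_j\ge0)\vee\Phi'$ with $m,n\ge1$, $w'_1,\dots,w'_m<0<w_1,\dots,w_n$, where $\Phi$ contains no positive occurrence of $x_i$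 and $\Phi'$ contains no negative occurrence of $x_i$ ($\Phi,\Phi'$ are possibly empty disjunctions of linear inequalities). Then $$\mathrm{CPres}_i(\Psi,\Psi')=\bigvee_{j=1}^m\bigvee_{k=1}^n\left(\frac{\varphi_k}{w_k}-\frac{\varphi'_j}{w'_j}\ge0\right)\vee\Phi\vee\Phi'.$$ Variable elimination. Set $\Pi_D=\Pi$. For $i=D,\dots,1$, given $\Pi_i$, let $\Pi_i^+$ be the set of constraints in $\Pi_i$ with positive and without negative occurrences of $x_i$; $\Pi_i^-$ the set of those with negative and without positive occurrences of $x_i$; $\Pi_i^{\pm}$ the set of those with both positive and negative occurrences of $x_i$. Let $\Pi_i^0=\Pi_i^+$, $\Pi_i^{k+1}=\{\mathrm{CPres}_i(\Psi,\Psi')\mid\Psi\in\Pi_i^k,\ \Psi'\in\Pi_i^\pm\}$, and $\Pi_i^{++}=\bigcup_{k=0}^{|\Pi_i^\pm|}\Pi_i^k$. Define $$\Pi_{i-1}=\bigl(\Pi_i\setminus(\Pi_i^+\cup\Pi_i^-\cup\Pi_i^\pm)\bigr)\cup\{\mathrm{CPres}_i(\Psi,\Psi')\mid\Psi\in\Pi_i^{++},\ \Psi'\in\Pi_i^-\}.$$ Boundaries. For a constraint $\Psi$ in the single variable $x_i$, let $$l_i^\Psi=\max_{(w_ix_i+\varphi\ge0)\in\Psi:\,w_i<0}\left(-\frac{\varphi}{w_i}\right),\qquad r_i^\Psi=\min_{(w_ix_i+\varphi\ge0)\in\Psi:\,w_i>0}\left(-\frac{\varphi}{w_i}\right),$$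 with the conventions $\max\emptyset=-\infty$, $\min\emptyset=+\infty$. Definition of $\mathrm{DRL}(\tilde x)$. The components $\mathrm{DRL}(\tilde x)_1,\dots,\mathrm{DRL}(\tilde x)_D$ are computed successively for $i=1,\dots,D$. Let $\widetilde\Pi_i$ be the set of constraints in the variable $x_i$ obtained from $\Pi_i$ by substituting $x_1,\dots,x_{i-1}$ with $\mathrm{DRL}(\tilde x)_1,\dots,\mathrm{DRL}(\tilde x)_{i-1}$. For a real value $v$, write $v\in\Omega(\widetilde\Pi_i)$ if assigning $v$ to $x_i$ satisfies $\widetilde\Pi_i$ ($\pm\infty$ never belong to $\Omega(\widetilde\Pi_i)$). Let $$l_i=\max\{l_i^\Psi:\Psi\in\widetilde\Pi_i,\ \tilde x_i>l_i^\Psi,\ l_i^\Psi\in\Omega(\widetilde\Pi_i)\},\qquad r_i=\min\{r_i^\Psi:\Psi\in\widetilde\Pi_i,\ \tilde x_i<r_i^\Psi,\ r_i^\Psi\in\Omega(\widetilde\Pi_i)\}.$$ Then $\mathrm{DRL}(\tilde x)_i=\tilde x_i$ if $\tilde x_i\in\Omega(\widetilde\Pi_i)$; $\mathrm{DRL}(\tilde x)_i=l_i$ if $\tilde x_i\notin\Omega(\widetilde\Pi_i)$ and $|\tilde x_i-l_i|<|\tilde x_i-r_i|$; and $\mathrm{DRL}(\tilde x)_i=r_i$ otherwise (with $|\tilde x_i-(\pm\infty)|=+\infty$). *)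

theory Defs
  imports "HOL-Analysis.Analysis"
begin

text \<open>
  The variables are the elements of a finite type \<open>'v\<close>, so \<open>D = CARD('v)\<close>.
  The pair \<open>(w, b)\<close> stands for the linear inequality \<open>(\<Sum>k. w\<^sub>k * x\<^sub>k) + b \<ge> 0\<close>;
  a constraint is the set of its disjuncts. Finiteness of constraints and of sets of constraints
  is not part of the types and has to be assumed where needed. Sets of constraints are called \<open>\<C>\<close>,
  as the capital letter pi is the binder of dependent function spaces.
\<close>

type_synonym 'v lineq = "(real ^ 'v) \<times> real"
type_synonym 'v constraint = "'v lineq set"

definition sat_lineq :: "real ^ 'v \<Rightarrow> 'v::finite lineq \<Rightarrow> bool" where
  "sat_lineq x l \<longleftrightarrow> fst l \<bullet> x + snd l \<ge> 0"

definition satisfies :: "real ^ 'v \<Rightarrow> 'v::finite constraint \<Rightarrow> bool" where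
  "satisfies x \<Psi> \<longleftrightarrow> (\<exists>l\<in>\<Psi>. sat_lineq x l)"

definition Omega :: "'v::finite constraint set \<Rightarrow> (real ^ 'v) set" where
  "Omega \<C> = {x. \<forall>\<Psi>\<in>\<C>. satisfies x \<Psi>}"

definition satisfiable :: "'v::finite constraint set \<Rightarrow> bool" where
  "satisfiable \<C> \<longleftrightarrow> Omega \<C> \<noteq> {}"

text \<open>\<open>\<sigma> i\<close> is the \<open>i\<close>-th variable of the ordering, for \<open>1 \<le> i \<le> D\<close>.\<close>

definition variable_ordering :: "(nat \<Rightarrow> 'v::finite) \<Rightarrow> bool" where
  "variable_ordering \<sigma> \<longleftrightarrow> bij_betw \<sigma> {1..CARD('v)} UNIV"


section \<open>Resolution and variable elimination\<close>

definition pos_part :: "'v::finite \<Rightarrow> 'v constraint \<Rightarrow> 'v constraint" where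
  "pos_part i \<Psi> = {l \<in> \<Psi>. fst l $ i > 0}"

definition neg_part :: "'v::finite \<Rightarrow> 'v constraint \<Rightarrow> 'v constraint" where
  "neg_part i \<Psi> = {l \<in> \<Psi>. fst l $ i < 0}"

text \<open>The affine expression \<open>\<phi>\<close> in \<open>w\<^sub>i * x\<^sub>i + \<phi> \<ge> 0\<close>.\<close>

definition remainder :: "'v::finite \<Rightarrow> 'v lineq \<Rightarrow> 'v lineq" where
  "remainder i l = ((\<chi> k. if k = i then 0 else fst l $ k), snd l)"

text \<open>
  Since \<open>\<Phi>\<close> has no positive and \<open>\<Phi>'\<close> no negative occurrence of \<open>x\<^sub>i\<close>, they are determined by
  \<open>\<Psi>\<close> and \<open>\<Psi>'\<close>. The first component uses the vector space structure of pairs. The rule is meant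
  for \<open>pos_part i \<Psi>\<close> and \<open>neg_part i \<Psi>'\<close> nonempty, which holds wherever it is used below.
\<close>

definition CPres :: "'v::finite \<Rightarrow> 'v constraint \<Rightarrow> 'v constraint \<Rightarrow> 'v constraint" where
  "CPres i \<Psi> \<Psi>' =
     {remainder i l /\<^sub>R (fst l $ i) - remainder i l' /\<^sub>R (fst l' $ i) | l l'.
        l \<in> pos_part i \<Psi> \<and> l' \<in> neg_part i \<Psi>'}
     \<union> (\<Psi> - pos_part i \<Psi>) \<union> (\<Psi>' - neg_part i \<Psi>')"

definition Pi_plus :: "'v::finite \<Rightarrow> 'v constraint set \<Rightarrow> 'v constraint set" where
  "Pi_plus i \<C> = {\<Psi> \<in> \<C>. pos_part i \<Psi> \<noteq> {} \<and> neg_part i \<Psi> = {}}"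

definition Pi_minus :: "'v::finite \<Rightarrow> 'v constraint set \<Rightarrow> 'v constraint set" where
  "Pi_minus i \<C> = {\<Psi> \<in> \<C>. neg_part i \<Psi> \<noteq> {} \<and> pos_part i \<Psi> = {}}"

definition Pi_pm :: "'v::finite \<Rightarrow> 'v constraint set \<Rightarrow> 'v constraint set" where
  "Pi_pm i \<C> = {\<Psi> \<in> \<C>. pos_part i \<Psi> \<noteq> {} \<and> neg_part i \<Psi> \<noteq> {}}"

primrec Pi_iter :: "'v::finite \<Rightarrow> 'v constraint set \<Rightarrow> nat \<Rightarrow> 'v constraint set" where
  "Pi_iter i \<C> 0 = Pi_plus i \<C>"
| "Pi_iter i \<C> (Suc k) = {CPres i \<Psi> \<Psi>' | \<Psi> \<Psi>'. \<Psi> \<in> Pi_iter i \<C> k \<and> \<Psi>' \<in> Pi_pm i \<C>}"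

definition Pi_plusplus :: "'v::finite \<Rightarrow> 'v constraint set \<Rightarrow> 'v constraint set" where
  "Pi_plusplus i \<C> = (\<Union>k \<in> {0..card (Pi_pm i \<C>)}. Pi_iter i \<C> k)"

definition eliminate :: "'v::finite \<Rightarrow> 'v constraint set \<Rightarrow> 'v constraint set" where
  "eliminate i \<C> =
     (\<C> - (Pi_plus i \<C> \<union> Pi_minus i \<C> \<union> Pi_pm i \<C>))
     \<union> {CPres i \<Psi> \<Psi>' | \<Psi> \<Psi>'. \<Psi> \<in> Pi_plusplus i \<C> \<and> \<Psi>' \<in> Pi_minus i \<C>}"

text \<open>\<open>elim_last \<sigma> \<C> n\<close> eliminates the last \<open>n\<close> variables of the ordering, the last one first.\<close>

primrec elim_last ::
  "(nat \<Rightarrow> 'v::finite) \<Rightarrow> 'v constraint set \<Rightarrow> nat \<Rightarrow> 'v constraint set" where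
  "elim_last \<sigma> \<C> 0 = \<C>"
| "elim_last \<sigma> \<C> (Suc n) = eliminate (\<sigma> (CARD('v) - n)) (elim_last \<sigma> \<C> n)"

text \<open>The set \<open>\<C>\<^sub>i\<close>, in which only \<open>\<sigma> 1, \<dots>, \<sigma> i\<close> may occur.\<close>

definition Pi_stage ::
  "(nat \<Rightarrow> 'v::finite) \<Rightarrow> 'v constraint set \<Rightarrow> nat \<Rightarrow> 'v constraint set" where
  "Pi_stage \<sigma> \<C> i = elim_last \<sigma> \<C> (CARD('v) - i)"


section \<open>Boundaries\<close>

text \<open>
  These are meant for constraints in the single variable \<open>x\<^sub>i\<close>, for which \<open>\<phi>\<close> is the constant
  \<open>snd l\<close>. On finite sets \<open>SUP\<close> and \<open>INF\<close> of extended reals are the maximum and minimum, with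
  value \<open>-\<infinity>\<close> and \<open>\<infinity>\<close>, respectively, on the empty set.
\<close>

definition left_bound :: "'v::finite \<Rightarrow> 'v constraint \<Rightarrow> ereal" where
  "left_bound i \<Psi> = (SUP l \<in> neg_part i \<Psi>. ereal (- (snd l / fst l $ i)))"

definition right_bound :: "'v::finite \<Rightarrow> 'v constraint \<Rightarrow> ereal" where
  "right_bound i \<Psi> = (INF l \<in> pos_part i \<Psi>. ereal (- (snd l / fst l $ i)))"


section \<open>The layer\<close>

definition subst_lineq :: "'v::finite set \<Rightarrow> ('v \<Rightarrow> real) \<Rightarrow> 'v lineq \<Rightarrow> 'v lineq" where
  "subst_lineq S y l =
     ((\<chi> k. if k \<in> S then 0 else fst l $ k), snd l + (\<Sum>k\<in>S. fst l $ k * y k))"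

definition subst_constraints ::
  "'v::finite set \<Rightarrow> ('v \<Rightarrow> real) \<Rightarrow> 'v constraint set \<Rightarrow> 'v constraint set" where
  "subst_constraints S y \<C> = (\<lambda>\<Psi>. subst_lineq S y ` \<Psi>) ` \<C>"

text \<open>
  The values satisfying a set of constraints in the single variable \<open>x\<^sub>i\<close>, embedded in the extended
  reals. The entries of \<open>axis i v\<close> other than the \<open>i\<close>-th are irrelevant for such constraints.
\<close>

definition feasible :: "'v::finite \<Rightarrow> 'v constraint set \<Rightarrow> ereal set" where
  "feasible i \<C> = ereal ` {v. axis i v \<in> Omega \<C>}"

definition drl_left :: "'v::finite \<Rightarrow> 'v constraint set \<Rightarrow> real \<Rightarrow> ereal" where
  "drl_left i \<C> t =
     Sup {left_bound i \<Psi> | \<Psi>. \<Psi> \<in> \<C> \<and> ereal t > left_bound i \<Psi> \<and> left_bound i \<Psi> \<in> feasible i \<C>}"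

definition drl_right :: "'v::finite \<Rightarrow> 'v constraint set \<Rightarrow> real \<Rightarrow> ereal" where
  "drl_right i \<C> t =
     Inf {right_bound i \<Psi> | \<Psi>. \<Psi> \<in> \<C> \<and> ereal t < right_bound i \<Psi> \<and> right_bound i \<Psi> \<in> feasible i \<C>}"

definition drl_value :: "'v::finite \<Rightarrow> 'v constraint set \<Rightarrow> real \<Rightarrow> ereal" where
  "drl_value i \<C> t =
     (if ereal t \<in> feasible i \<C> then ereal t
      else if \<bar>ereal t - drl_left i \<C> t\<bar> < \<bar>ereal t - drl_right i \<C> t\<bar> then drl_left i \<C> t
      else drl_right i \<C> t)"

text \<open>
  After \<open>i\<close> steps the values at \<open>\<sigma> 1, \<dots>, \<sigma> i\<close> have been computed; the initial values \<open>0\<close> are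
  never used. The defining formula can a priori produce an infinite value, so the components are
  extended reals. That they are in fact real is left to be proved; \<open>real_of_ereal\<close> makes
  the recursion total.
\<close>

primrec drl_upto ::
  "(nat \<Rightarrow> 'v::finite) \<Rightarrow> 'v constraint set \<Rightarrow> real ^ 'v \<Rightarrow> nat \<Rightarrow> 'v \<Rightarrow> ereal" where
  "drl_upto \<sigma> \<C> x 0 = (\<lambda>_. 0)"
| "drl_upto \<sigma> \<C> x (Suc i) =
     (drl_upto \<sigma> \<C> x i)
       (\<sigma> (Suc i) :=
          drl_value (\<sigma> (Suc i))
            (subst_constraints (\<sigma> ` {1..i}) (\<lambda>k. real_of_ereal (drl_upto \<sigma> \<C> x i k))
              (Pi_stage \<sigma> \<C> (Suc i)))
            (x $ \<sigma> (Suc i)))"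

definition DRL :: "(nat \<Rightarrow> 'v::finite) \<Rightarrow> 'v constraint set \<Rightarrow> real ^ 'v \<Rightarrow> 'v \<Rightarrow> ereal" where
  "DRL \<sigma> \<C> x = drl_upto \<sigma> \<C> x CARD('v)"

end

theory Submission
  imports Defs
begin

text \<open>
  Fix all variables but one, \<open>x\<^sub>s\<close>. A constraint with only positive occurrences of \<open>x\<^sub>s\<close> becomes a
  lower bound for \<open>x\<^sub>s\<close>, one with only negative occurrences an upper bound, and one with both
  forbids an open interval. Start from the greatest lower bound and, as long as the current value
  lies in a forbidden interval, move to the right end of that interval. Each constraint with both
  occurrences is used at most once, and the bound reached after \<open>k\<close> moves is witnessed by a
  constraint in the \<open>k\<close>-th set of iterated resolvents. So the process stops at a value that
  satisfies everything, unless it passes an upper bound, in which case a resolvent in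
  \<open>eliminate s \<C>\<close> is violated. Hence every solution of \<open>eliminate s \<C>\<close> extends to a solution
  of \<open>\<C>\<close>, and each step of the layer faces a nonempty set of feasible values.
  If \<open>v < t\<close> with \<open>v\<close> feasible and \<open>t\<close> not, the least left boundary in \<open>[v, t)\<close> is
  feasible (symmetrically for \<open>t < v\<close>), so the layer always picks a feasible real value.
\<close>

section \<open>Varying a single coordinate\<close>

definition coord_upd :: "'v::finite \<Rightarrow> real ^ 'v \<Rightarrow> real \<Rightarrow> real ^ 'v" where
  "coord_upd s p v = (\<chi> k. if k = s then v else p $ k)"

text \<open>The point where the boundary hyperplane of \<open>l\<close> meets the line through
  \<open>p\<close> in direction \<open>s\<close>. It does not depend on \<open>p $ s\<close>, and is
  meant for a nonzero coefficient of \<open>s\<close>.\<close>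

definition lineq_root :: "'v::finite \<Rightarrow> real ^ 'v \<Rightarrow> 'v lineq \<Rightarrow> real" where
  "lineq_root s p l = - (fst (remainder s l) \<bullet> p + snd l) / fst l $ s"

lemma coord_upd_nth [simp]: "coord_upd s p v $ k = (if k = s then v else p $ k)"
  by (simp add: coord_upd_def)

lemma coord_upd_self [simp]: "coord_upd s p (p $ s) = p"
  by (simp add: vec_eq_iff)

lemma axis_eq_coord_upd: "axis s v = coord_upd s 0 v"
  by (simp add: vec_eq_iff axis_def)

lemma snd_remainder [simp]: "snd (remainder s l) = snd l"
  by (simp add: remainder_def)

lemma fst_remainder_nth [simp]: "fst (remainder s l) $ k = (if k = s then 0 else fst l $ k)"
  by (simp add: remainder_def)

lemma inner_coord_upd:
  "fst l \<bullet> coord_upd s p v = fst l $ s * v + fst (remainder s l) \<bullet> p"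
proof -
  have "fst l \<bullet> coord_upd s p v
      = (\<Sum>k\<in>UNIV. (if k = s then fst l $ s * v else 0) + fst (remainder s l) $ k * p $ k)"
    unfolding inner_vec_def by (rule sum.cong) auto
  then show ?thesis
    by (simp add: sum.distrib inner_vec_def)
qed

lemma sat_lineq_coord_upd:
  "sat_lineq (coord_upd s p v) l \<longleftrightarrow> fst l $ s * v + (fst (remainder s l) \<bullet> p + snd l) \<ge> 0"
  by (simp add: sat_lineq_def inner_coord_upd add.assoc)

lemma sat_lineq_coord_upd_pos:
  "fst l $ s > 0 \<Longrightarrow> sat_lineq (coord_upd s p v) l \<longleftrightarrow> lineq_root s p l \<le> v"
  by (auto simp: sat_lineq_coord_upd lineq_root_def field_simps)

lemma sat_lineq_coord_upd_neg:
  "fst l $ s < 0 \<Longrightarrow> sat_lineq (coord_upd s p v) l \<longleftrightarrow> v \<le> lineq_root s p l"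
  by (auto simp: sat_lineq_coord_upd lineq_root_def field_simps)

lemma sat_lineq_coord_upd_zero:
  "fst l $ s = 0 \<Longrightarrow> sat_lineq (coord_upd s p v) l \<longleftrightarrow> sat_lineq p l"
  \<comment> \<open>Reading \<open>p\<close> as \<open>coord_upd s p (p $ s)\<close> brings both
    sides to the same form.\<close>
  using sat_lineq_coord_upd[of s p "p $ s" l] by (simp add: sat_lineq_coord_upd)

lemma sat_lineq_coord_upd_mono:
  "\<lbrakk>sat_lineq (coord_upd s p v) l; fst l $ s \<ge> 0; v \<le> u\<rbrakk> \<Longrightarrow> sat_lineq (coord_upd s p u) l"
  using mult_left_mono[of v u "fst l $ s"] by (auto simp: sat_lineq_coord_upd)

lemma satisfiesI: "\<lbrakk>l \<in> \<Psi>; sat_lineq x l\<rbrakk> \<Longrightarrow> satisfies x \<Psi>"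
  unfolding satisfies_def by blast

lemma satisfies_coord_upd_mono:
  "\<lbrakk>satisfies (coord_upd s p v) \<Psi>; neg_part s \<Psi> = {}; v \<le> u\<rbrakk>
    \<Longrightarrow> satisfies (coord_upd s p u) \<Psi>"
  unfolding satisfies_def neg_part_def
  by (fastforce intro: sat_lineq_coord_upd_mono simp: not_less)

lemma coeff_eq_zero:
  "\<lbrakk>l \<in> \<Psi>; l \<notin> pos_part s \<Psi>; l \<notin> neg_part s \<Psi>\<rbrakk> \<Longrightarrow> fst l $ s = 0"
  by (simp add: pos_part_def neg_part_def)

lemma satisfies_coord_upd_const:
  assumes "pos_part s \<Psi> = {}" "neg_part s \<Psi> = {}"
  shows "satisfies (coord_upd s p v) \<Psi> \<longleftrightarrow> satisfies p \<Psi>"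
proof -
  have "sat_lineq (coord_upd s p v) l \<longleftrightarrow> sat_lineq p l" if "l \<in> \<Psi>" for l
    using that assms
    by (intro sat_lineq_coord_upd_zero) (auto intro: coeff_eq_zero)
  then show ?thesis
    unfolding satisfies_def by blast
qed

text \<open>A disjunct violated at \<open>a\<close> without positive coefficient stays violated to
  the right of \<open>a\<close>, so from \<open>a\<close> on only the positive disjuncts matter, and
  \<open>r\<close> is their least root. This serves both lower bounds and right ends of forbidden
  intervals.\<close>

lemma pos_threshold:
  assumes fin: "finite \<Psi>" and pos: "pos_part s \<Psi> \<noteq> {}"
    and unsat: "\<not> satisfies (coord_upd s p a) \<Psi>"
  obtains r where "a < r"
    and "\<And>v. \<lbrakk>a \<le> v; v < r\<rbrakk> \<Longrightarrow> \<not> satisfies (coord_upd s p v) \<Psi>"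
    and "\<And>v. r \<le> v \<Longrightarrow> satisfies (coord_upd s p v) \<Psi>"
proof
  define R where "R = lineq_root s p ` pos_part s \<Psi>"
  have R: "finite R" "R \<noteq> {}"
    using fin pos by (auto simp: R_def pos_part_def)
  obtain l0 where l0: "l0 \<in> \<Psi>" "fst l0 $ s > 0" "Min R = lineq_root s p l0"
    using Min_in[OF R] by (auto simp: R_def pos_part_def)
  show "a < Min R"
    using unsat l0 by (auto simp: satisfies_def sat_lineq_coord_upd_pos not_le)
  show "\<not> satisfies (coord_upd s p v) \<Psi>" if v: "a \<le> v" "v < Min R" for v
  proof
    assume "satisfies (coord_upd s p v) \<Psi>"
    then obtain l where l: "l \<in> \<Psi>" "sat_lineq (coord_upd s p v) l"
      unfolding satisfies_def by blast
    have na: "\<not> sat_lineq (coord_upd s p a) l"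
      using l unsat unfolding satisfies_def by blast
    consider "fst l $ s > 0" | "fst l $ s < 0" | "fst l $ s = 0"
      by linarith
    then show False
    proof cases
      case 1
      then have "lineq_root s p l \<in> R"
        using l by (auto simp: R_def pos_part_def)
      then have "Min R \<le> lineq_root s p l"
        using R by simp
      then show False
        using l v 1 by (simp add: sat_lineq_coord_upd_pos)
    qed (use l na v in \<open>auto simp: sat_lineq_coord_upd_neg sat_lineq_coord_upd_zero\<close>)
  qed
  show "satisfies (coord_upd s p v) \<Psi>" if "Min R \<le> v" for v
    using that l0 by (intro satisfiesI[of l0]) (auto simp: sat_lineq_coord_upd_pos)
qed

text \<open>Phrased with \<open>at_bot\<close> so that finitely many constraints can be satisfied at
  one common value far to the left.\<close>

lemma eventually_satisfies_at_bot:
  assumes "neg_part s \<Psi> \<noteq> {}"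
  shows "\<forall>\<^sub>F v in at_bot. satisfies (coord_upd s p v) \<Psi>"
proof -
  obtain l where "l \<in> \<Psi>" "fst l $ s < 0"
    using assms by (auto simp: neg_part_def)
  then show ?thesis
    unfolding eventually_at_bot_linorder
    by (intro exI[of _ "lineq_root s p l"] allI impI satisfiesI[of l]) (auto simp: sat_lineq_coord_upd_neg)
qed

section \<open>Resolution\<close>

lemma CPres_cases:
  assumes "m \<in> CPres s \<Psi> \<Psi>'"
  obtains (resolvent) l l' where "l \<in> pos_part s \<Psi>" "l' \<in> neg_part s \<Psi>'"
      "m = remainder s l /\<^sub>R fst l $ s - remainder s l' /\<^sub>R fst l' $ s"
    | (left) "m \<in> \<Psi> - pos_part s \<Psi>"
    | (right) "m \<in> \<Psi>' - neg_part s \<Psi>'"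
  using assms unfolding CPres_def by blast

text \<open>Divided by the coefficient of \<open>s\<close>, the remainder of an inequality evaluates
  at \<open>p\<close> to minus its root, so the resolvent compares two roots. It does not contain
  \<open>s\<close>, hence \<open>v\<close> is arbitrary.\<close>

lemma sat_lineq_resolvent:
  assumes "l \<in> pos_part s \<Psi>" "l' \<in> neg_part s \<Psi>'"
  shows "sat_lineq (coord_upd s p v) (remainder s l /\<^sub>R fst l $ s - remainder s l' /\<^sub>R fst l' $ s)
    \<longleftrightarrow> lineq_root s p l \<le> lineq_root s p l'" (is "sat_lineq _ ?m \<longleftrightarrow> _")
proof -
  have "sat_lineq (coord_upd s p v) ?m \<longleftrightarrow> sat_lineq p ?m"
    by (rule sat_lineq_coord_upd_zero) simp
  also have "\<dots> \<longleftrightarrow> lineq_root s p l \<le> lineq_root s p l'"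
    by (simp add: sat_lineq_def lineq_root_def divide_inverse algebra_simps)
  finally show ?thesis .
qed

text \<open>Soundness: if the two disjuncts that hold form a resolved pair, then
  \<open>p $ s\<close> lies between their roots; otherwise one of them is kept in the
  resolvent.\<close>

lemma satisfies_CPres:
  assumes "satisfies p \<Psi>" "satisfies p \<Psi>'"
  shows "satisfies p (CPres s \<Psi> \<Psi>')"
proof -
  obtain l l' where l: "l \<in> \<Psi>" "sat_lineq p l" "l' \<in> \<Psi>'" "sat_lineq p l'"
    using assms unfolding satisfies_def by blast
  show ?thesis
  proof (cases "l \<in> pos_part s \<Psi> \<and> l' \<in> neg_part s \<Psi>'")
    case True
    let ?m = "remainder s l /\<^sub>R fst l $ s - remainder s l' /\<^sub>R fst l' $ s"
    have "lineq_root s p l \<le> p $ s" "p $ s \<le> lineq_root s p l'"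
      using True l sat_lineq_coord_upd_pos[of l s p "p $ s"] sat_lineq_coord_upd_neg[of l' s p "p $ s"]
      by (auto simp: pos_part_def neg_part_def)
    then have "sat_lineq p ?m"
      using sat_lineq_resolvent[of l s \<Psi> l' \<Psi>' p "p $ s"] True by simp
    moreover have "?m \<in> CPres s \<Psi> \<Psi>'"
      using True unfolding CPres_def by blast
    ultimately show ?thesis
      unfolding satisfies_def by blast
  next
    case False
    then show ?thesis
      using l unfolding satisfies_def CPres_def by blast
  qed
qed

text \<open>A resolvent records one move of the process: \<Psi> witnesses the bound
  \<open>a\<close>, \<Psi>' forbids the interval from \<open>a\<close> to \<open>r\<close>, and the
  resolvent witnesses the new bound \<open>r\<close>.\<close>

lemma unsat_CPres:
  assumes neg: "neg_part s \<Psi> = {}"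
    and below: "\<And>v. v < a \<Longrightarrow> \<not> satisfies (coord_upd s p v) \<Psi>"
    and "a < r"
    and between: "\<And>v. \<lbrakk>a \<le> v; v < r\<rbrakk> \<Longrightarrow> \<not> satisfies (coord_upd s p v) \<Psi>'"
    and "v < r"
  shows "\<not> satisfies (coord_upd s p v) (CPres s \<Psi> \<Psi>')"
proof
  assume "satisfies (coord_upd s p v) (CPres s \<Psi> \<Psi>')"
  then obtain m where m: "m \<in> CPres s \<Psi> \<Psi>'" "sat_lineq (coord_upd s p v) m"
    unfolding satisfies_def by blast
  from m(1) show False
  proof (cases rule: CPres_cases)
    case (resolvent l l')
    note res = this
    \<comment> \<open>The value \<open>a\<close> separates the two roots in the opposite
      order.\<close>
    have "lineq_root s p l \<le> lineq_root s p l'"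
      using sat_lineq_resolvent[OF res(1,2)] m(2) unfolding res(3) by blast
    moreover have "lineq_root s p l \<ge> a"
    proof (rule ccontr)
      assume "\<not> a \<le> lineq_root s p l"
      moreover have "satisfies (coord_upd s p (lineq_root s p l)) \<Psi>"
        using res(1) by (intro satisfiesI[of l]) (auto simp: pos_part_def sat_lineq_coord_upd_pos)
      ultimately show False
        using below by simp
    qed
    moreover have "lineq_root s p l' < a"
      using between[of a] \<open>a < r\<close> res(2)
      by (auto simp: satisfies_def neg_part_def sat_lineq_coord_upd_neg not_le)
    ultimately show False
      by linarith
  next
    case left
    then have "m \<in> \<Psi>" "fst m $ s = 0"
      using neg coeff_eq_zero[of m \<Psi> s] by auto
    \<comment> \<open>As \<open>m\<close> does not contain \<open>s\<close>, it would also hold at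
      any value below \<open>a\<close>.\<close>
    then have "satisfies (coord_upd s p (a - 1)) \<Psi>"
      using m(2) by (intro satisfiesI[of m]) (auto simp: sat_lineq_coord_upd_zero)
    then show False
      using below[of "a - 1"] by simp
  next
    case right
    then have "m \<in> \<Psi>'" "fst m $ s \<ge> 0"
      by (auto simp: neg_part_def)
    \<comment> \<open>With a nonnegative coefficient, \<open>m\<close> would still hold after moving
      right into the forbidden interval.\<close>
    then have "satisfies (coord_upd s p (max a v)) \<Psi>'"
      using m(2) sat_lineq_coord_upd_mono[of s p v m "max a v"] by (auto simp: satisfies_def)
    then show False
      using between[of "max a v"] \<open>a < r\<close> \<open>v < r\<close> by simp
  qed
qed

lemma resolvent_nth:
  "fst (remainder s l /\<^sub>R a - remainder s l' /\<^sub>R b) $ s = 0"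
  by simp

lemma neg_part_CPres:
  assumes "neg_part s \<Psi> = {}"
  shows "neg_part s (CPres s \<Psi> \<Psi>') = {}"
proof (rule equals0I)
  fix m assume "m \<in> neg_part s (CPres s \<Psi> \<Psi>')"
  then have "m \<in> CPres s \<Psi> \<Psi>'" "fst m $ s < 0"
    by (simp_all add: neg_part_def)
  then show False
    using assms
    by (cases rule: CPres_cases) (auto simp: resolvent_nth neg_part_def simp del: split_paired_All)
qed

lemma pos_part_CPres:
  assumes "pos_part s \<Psi>' = {}"
  shows "pos_part s (CPres s \<Psi> \<Psi>') = {}"
proof (rule equals0I)
  fix m assume "m \<in> pos_part s (CPres s \<Psi> \<Psi>')"
  then have "m \<in> CPres s \<Psi> \<Psi>'" "fst m $ s > 0"
    by (simp_all add: pos_part_def)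
  then show False
    using assms
    by (cases rule: CPres_cases) (auto simp: resolvent_nth pos_part_def simp del: split_paired_All)
qed

text \<open>Iterated resolvents remain lower bounds: the first premise has no negative occurrence,
  and all those of the second are resolved away.\<close>

lemma neg_part_Pi_iter: "\<Psi> \<in> Pi_iter s \<C> k \<Longrightarrow> neg_part s \<Psi> = {}"
  by (induction k arbitrary: \<Psi>) (auto simp: Pi_plus_def dest: neg_part_CPres)

section \<open>Variable elimination\<close>

lemma Pi_iter_satisfied:
  "\<lbrakk>p \<in> Omega \<C>; \<Psi> \<in> Pi_iter s \<C> k\<rbrakk> \<Longrightarrow> satisfies p \<Psi>"
  by (induction k arbitrary: \<Psi>)
    (auto simp: Omega_def Pi_plus_def Pi_pm_def intro!: satisfies_CPres)

lemma Omega_subset_eliminate: "Omega \<C> \<subseteq> Omega (eliminate s \<C>)"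
proof
  fix p assume p: "p \<in> Omega \<C>"
  have "satisfies p \<Psi>" if "\<Psi> \<in> eliminate s \<C>" for \<Psi>
    using that p Pi_iter_satisfied[OF p]
    by (auto simp: eliminate_def Omega_def Pi_plusplus_def Pi_minus_def intro!: satisfies_CPres)
  then show "p \<in> Omega (eliminate s \<C>)"
    by (simp add: Omega_def)
qed

text \<open>Completeness of elimination, by contradiction: without a solution the process could
  always move once more, but each move uses up a constraint of \<open>Pi_pm s \<C>\<close>.\<close>

lemma eliminate_extends:
  assumes finC: "finite \<C>" and fin: "\<And>\<Psi>. \<Psi> \<in> \<C> \<Longrightarrow> finite \<Psi>"
    and p: "p \<in> Omega (eliminate s \<C>)"
  obtains v where "coord_upd s p v \<in> Omega \<C>"
proof -
  define sat where "sat v \<Psi> = satisfies (coord_upd s p v) \<Psi>" for v \<Psi>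
  have other: "sat v \<Psi>"
    if "\<Psi> \<in> \<C>" "\<Psi> \<notin> Pi_plus s \<C>" "\<Psi> \<notin> Pi_minus s \<C>" "\<Psi> \<notin> Pi_pm s \<C>" for \<Psi> v
  proof -
    have "satisfies p \<Psi>"
      using that p by (auto simp: Omega_def eliminate_def)
    moreover have "pos_part s \<Psi> = {}" "neg_part s \<Psi> = {}"
      using that by (auto simp: Pi_plus_def Pi_minus_def Pi_pm_def)
    ultimately show ?thesis
      by (simp add: sat_def satisfies_coord_upd_const)
  qed
  \<comment> \<open>The state after \<open>k\<close> moves: the current value is \<open>a\<close>.\<close>
  define state where "state k a \<longleftrightarrow> (\<exists>\<Psi>\<in>Pi_iter s \<C> k. \<forall>v<a. \<not> sat v \<Psi>)
      \<and> (\<forall>\<Psi>\<in>Pi_plus s \<C>. \<forall>v\<ge>a. sat v \<Psi>)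
      \<and> k \<le> card {\<Psi>\<in>Pi_pm s \<C>. \<forall>v\<ge>a. sat v \<Psi>}" for k a
  have finpm: "finite (Pi_pm s \<C>)"
    using finC by (simp add: Pi_pm_def)
  have "\<exists>v. coord_upd s p v \<in> Omega \<C>"
  proof (rule ccontr)
    assume "\<not> ?thesis"
    then have no_sol: "\<exists>\<Psi>\<in>\<C>. \<not> sat v \<Psi>" for v
      by (auto simp: Omega_def sat_def)
    have "\<exists>a. state 0 a"
    proof -
      have "\<forall>\<^sub>F v in at_bot. \<forall>\<Psi>\<in>Pi_minus s \<C> \<union> Pi_pm s \<C>. sat v \<Psi>"
        unfolding sat_def using finC
        by (intro eventually_ball_finite)
          (auto simp: Pi_minus_def Pi_pm_def intro: eventually_satisfies_at_bot)
      then obtain M where M: "\<forall>\<Psi>\<in>Pi_minus s \<C> \<union> Pi_pm s \<C>. sat M \<Psi>"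
        using eventually_happens' trivial_limit_at_bot_linorder by blast
      \<comment> \<open>A lower bound may hold everywhere because of a disjunct without
        \<open>s\<close>; \<open>P\<close> keeps those with a genuine threshold. The constraint
        violated at \<open>M\<close> is one of them.\<close>
      define P where "P = {\<Psi>\<in>Pi_plus s \<C>. \<exists>v. \<not> sat v \<Psi>}"
      have "finite P"
        using finC by (simp add: P_def Pi_plus_def)
      have "P \<noteq> {}"
        using no_sol[of M] other[of _ M] M by (auto simp: P_def)
      have "\<exists>r. (\<forall>v<r. \<not> sat v \<Psi>) \<and> (\<forall>v\<ge>r. sat v \<Psi>)" if in_P: "\<Psi> \<in> P" for \<Psi>
      proof -
        obtain a where a: "\<not> sat a \<Psi>" and \<Psi>: "\<Psi> \<in> \<C>" "pos_part s \<Psi> \<noteq> {}" "neg_part s \<Psi> = {}"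
          using in_P unfolding P_def Pi_plus_def by blast
        obtain r where r: "a < r" "\<And>v. \<lbrakk>a \<le> v; v < r\<rbrakk> \<Longrightarrow> \<not> sat v \<Psi>" "\<And>v. r \<le> v \<Longrightarrow> sat v \<Psi>"
          using pos_threshold[OF fin[OF \<Psi>(1)] \<Psi>(2) a[unfolded sat_def]] unfolding sat_def by blast
        \<comment> \<open>The threshold only describes values from \<open>a\<close> on; below
          \<open>a\<close>, monotonicity applies.\<close>
        have "\<not> sat v \<Psi>" if "v < r" for v
          using r(2)[of v] a that satisfies_coord_upd_mono[OF _ \<Psi>(3), of p v a]
          unfolding sat_def by (meson linear)
        then show ?thesis
          using r(3) by blast
      qed
      then obtain r where r: "\<And>\<Psi> v. \<lbrakk>\<Psi> \<in> P; v < r \<Psi>\<rbrakk> \<Longrightarrow> \<not> sat v \<Psi>"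
          "\<And>\<Psi> v. \<lbrakk>\<Psi> \<in> P; v \<ge> r \<Psi>\<rbrakk> \<Longrightarrow> sat v \<Psi>"
        by metis
      have rP: "finite (r ` P)" "r ` P \<noteq> {}"
        using \<open>finite P\<close> \<open>P \<noteq> {}\<close> by auto
      obtain \<Psi>0 where \<Psi>0: "\<Psi>0 \<in> P" "Max (r ` P) = r \<Psi>0"
        using Max_in[OF rP] by auto
      \<comment> \<open>The process starts at the greatest threshold.\<close>
      have "state 0 (r \<Psi>0)"
        unfolding state_def
      proof (intro conjI ballI allI impI)
        show "\<exists>\<Psi>\<in>Pi_iter s \<C> 0. \<forall>v<r \<Psi>0. \<not> sat v \<Psi>"
        proof
          show "\<Psi>0 \<in> Pi_iter s \<C> 0"
            using \<Psi>0(1) by (simp add: P_def)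
          show "\<forall>v<r \<Psi>0. \<not> sat v \<Psi>0"
            using r(1)[OF \<Psi>0(1)] by blast
        qed
        show "sat v \<Psi>" if "\<Psi> \<in> Pi_plus s \<C>" "r \<Psi>0 \<le> v" for \<Psi> v
        proof (cases "\<Psi> \<in> P")
          case True
          then have "r \<Psi> \<le> r \<Psi>0"
            using rP \<Psi>0(2) by (metis Max_ge imageI)
          then show ?thesis
            using r(2)[OF True] that by simp
        qed (use that in \<open>auto simp: P_def\<close>)
      qed simp
      then show ?thesis ..
    qed
    \<comment> \<open>The bound on \<open>k\<close> ensures that the current witness belongs to
      \<open>Pi_plusplus s \<C>\<close>.\<close>
    moreover have step: "\<exists>b. state (Suc k) b" if st: "state k a" and k: "k \<le> card (Pi_pm s \<C>)" for k a
    proof -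
      obtain \<Psi> where \<Psi>: "\<Psi> \<in> Pi_iter s \<C> k" "\<And>v. v < a \<Longrightarrow> \<not> sat v \<Psi>"
        using st by (auto simp: state_def)
      note neg = neg_part_Pi_iter[OF \<Psi>(1)]
      obtain \<Psi>' where \<Psi>': "\<Psi>' \<in> \<C>" "\<not> sat a \<Psi>'"
        using no_sol by blast
      have "\<Psi>' \<notin> Pi_plus s \<C>"
        using st \<Psi>' by (auto simp: state_def)
      moreover have "\<Psi>' \<notin> Pi_minus s \<C>"
      proof
        assume minus: "\<Psi>' \<in> Pi_minus s \<C>"
        have unsat': "\<not> sat v \<Psi>'" if "a \<le> v" for v
        proof
          assume "sat v \<Psi>'"
          then obtain l where l: "l \<in> \<Psi>'" "sat_lineq (coord_upd s p v) l"
            by (auto simp: sat_def satisfies_def)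
          have "l \<notin> pos_part s \<Psi>'"
            using minus by (simp add: Pi_minus_def)
          then have "fst l $ s < 0 \<or> fst l $ s = 0"
            using l(1) by (auto simp: pos_part_def)
          then have "sat_lineq (coord_upd s p a) l"
            using l that by (auto simp: sat_lineq_coord_upd_neg sat_lineq_coord_upd_zero)
          then show False
            using l \<Psi>'(2) by (auto simp: sat_def satisfies_def)
        qed
        \<comment> \<open>Any value beyond both \<open>a\<close> and \<open>p $ s\<close> would do:
          the resolvent then fails at \<open>p\<close> itself, although it belongs to
          \<open>eliminate s \<C>\<close>.\<close>
        define r where "r = max (a + 1) (p $ s + 1)"
        have "\<not> satisfies (coord_upd s p (p $ s)) (CPres s \<Psi> \<Psi>')"
          using unsat_CPres[OF neg, of a p r \<Psi>' "p $ s"] \<Psi>(2) unsat'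
          by (simp add: sat_def r_def)
        moreover have "\<Psi> \<in> Pi_plusplus s \<C>"
          using \<Psi>(1) k by (auto simp: Pi_plusplus_def)
        then have "CPres s \<Psi> \<Psi>' \<in> eliminate s \<C>"
          using minus by (auto simp: eliminate_def)
        ultimately show False
          using p by (auto simp: Omega_def)
      qed
      ultimately have pm: "\<Psi>' \<in> Pi_pm s \<C>"
        using other \<Psi>' by blast
      then have "pos_part s \<Psi>' \<noteq> {}"
        by (simp add: Pi_pm_def)
      then obtain r where r: "a < r" "\<And>v. \<lbrakk>a \<le> v; v < r\<rbrakk> \<Longrightarrow> \<not> sat v \<Psi>'"
          "\<And>v. r \<le> v \<Longrightarrow> sat v \<Psi>'"
        using pos_threshold[OF fin[OF \<Psi>'(1)] _ \<Psi>'(2)[unfolded sat_def]] unfolding sat_def by blast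
      have "state (Suc k) r"
        unfolding state_def
      proof (intro conjI ballI allI impI)
        show "\<exists>\<Psi>\<in>Pi_iter s \<C> (Suc k). \<forall>v<r. \<not> sat v \<Psi>"
        proof
          show "CPres s \<Psi> \<Psi>' \<in> Pi_iter s \<C> (Suc k)"
            using \<Psi>(1) pm by auto
          show "\<forall>v<r. \<not> sat v (CPres s \<Psi> \<Psi>')"
            using unsat_CPres[OF neg \<Psi>(2)[unfolded sat_def] r(1,2)[unfolded sat_def]]
            unfolding sat_def by blast
        qed
        show "sat v \<Psi>" if "\<Psi> \<in> Pi_plus s \<C>" "r \<le> v" for \<Psi> v
          using st that r(1) by (auto simp: state_def)
        let ?A = "\<lambda>a. {\<Psi>\<in>Pi_pm s \<C>. \<forall>v\<ge>a. sat v \<Psi>}"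
        \<comment> \<open>The constraint \<Psi>' fails at \<open>a\<close> but holds from
          \<open>r\<close> on, so the move increases the count.\<close>
        have "?A a \<subset> ?A r"
        proof
          show "?A a \<subseteq> ?A r"
            using r(1) by auto
          have "\<Psi>' \<in> ?A r" "\<Psi>' \<notin> ?A a"
            using pm r(3) \<Psi>'(2) by auto
          then show "?A a \<noteq> ?A r"
            by blast
        qed
        then have "card (?A a) < card (?A r)"
          using finpm by (intro psubset_card_mono) auto
        then show "Suc k \<le> card (?A r)"
          using st by (simp add: state_def)
      qed
      then show ?thesis ..
    qed
    have "\<exists>a. state k a" if "k \<le> Suc (card (Pi_pm s \<C>))" for k
      using that
    proof (induction k)
      case 0
      show ?case by fact
    next
      case (Suc k)
      then show ?case
        using step by auto
    qed
    \<comment> \<open>One move more than there are constraints to use.\<close>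
    then obtain a where "state (Suc (card (Pi_pm s \<C>))) a"
      by blast
    moreover have "card {\<Psi>\<in>Pi_pm s \<C>. \<forall>v\<ge>a. sat v \<Psi>} \<le> card (Pi_pm s \<C>)"
      using finpm by (intro card_mono) auto
    ultimately show False
      by (simp add: state_def)
  qed
  then show thesis
    using that by blast
qed

section \<open>Finiteness under elimination\<close>

lemma finite_CPres:
  assumes "finite \<Psi>" "finite \<Psi>'"
  shows "finite (CPres s \<Psi> \<Psi>')"
  using assms unfolding CPres_def
  by (intro finite_UnI finite_image_set2) (auto simp: pos_part_def neg_part_def)

lemma finite_Pi_iter:
  assumes "finite \<C>"
  shows "finite (Pi_iter s \<C> k)"
proof (induction k)
  case 0
  show ?case
    using assms by (simp add: Pi_plus_def)
next
  case (Suc k)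
  have "finite (Pi_pm s \<C>)"
    using assms by (simp add: Pi_pm_def)
  then show ?case
    using Suc by (simp add: finite_image_set2)
qed

lemma finite_mem_Pi_iter:
  assumes "\<And>\<Psi>. \<Psi> \<in> \<C> \<Longrightarrow> finite \<Psi>" "\<Psi> \<in> Pi_iter s \<C> k"
  shows "finite \<Psi>"
  using assms(2)
  by (induction k arbitrary: \<Psi>) (auto simp: Pi_plus_def Pi_pm_def intro: finite_CPres assms(1))

lemma finite_eliminate:
  assumes "finite \<C>"
  shows "finite (eliminate s \<C>)"
proof -
  have "finite (Pi_plusplus s \<C>)" "finite (Pi_minus s \<C>)"
    using assms by (auto simp: Pi_plusplus_def Pi_minus_def finite_Pi_iter)
  then show ?thesis
    using assms by (simp add: eliminate_def finite_image_set2)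
qed

lemma eliminate_cases:
  assumes "\<Psi> \<in> eliminate s \<C>"
  obtains (kept) "\<Psi> \<in> \<C>" "pos_part s \<Psi> = {}" "neg_part s \<Psi> = {}"
    | (resolved) \<Psi>1 \<Psi>2 k where "\<Psi> = CPres s \<Psi>1 \<Psi>2" "\<Psi>1 \<in> Pi_iter s \<C> k" "\<Psi>2 \<in> \<C>"
      "pos_part s \<Psi>2 = {}"
  using assms unfolding eliminate_def Pi_plusplus_def Pi_plus_def Pi_minus_def Pi_pm_def
  by blast

lemma finite_mem_eliminate:
  assumes "\<And>\<Psi>. \<Psi> \<in> \<C> \<Longrightarrow> finite \<Psi>" "\<Psi> \<in> eliminate s \<C>"
  shows "finite \<Psi>"
  using assms(2)
proof (cases rule: eliminate_cases)
  case kept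
  then show ?thesis
    using assms(1) by simp
next
  case (resolved \<Psi>1 \<Psi>2 k)
  then show ?thesis
    using finite_CPres[OF finite_mem_Pi_iter[OF assms(1) resolved(2)] assms(1)] by simp
qed

section \<open>Variables occurring after elimination\<close>

definition constraint_vars :: "'v::finite constraint \<Rightarrow> 'v set" where
  "constraint_vars \<Psi> = {k. \<exists>l\<in>\<Psi>. fst l $ k \<noteq> 0}"

lemma constraint_vars_CPres:
  "constraint_vars (CPres s \<Psi> \<Psi>') \<subseteq> constraint_vars \<Psi> \<union> constraint_vars \<Psi>'"
proof
  fix k assume "k \<in> constraint_vars (CPres s \<Psi> \<Psi>')"
  then obtain m where m: "m \<in> CPres s \<Psi> \<Psi>'" "fst m $ k \<noteq> 0"
    by (auto simp: constraint_vars_def)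
  from m(1) show "k \<in> constraint_vars \<Psi> \<union> constraint_vars \<Psi>'"
  proof (cases rule: CPres_cases)
    case (resolvent l l')
    then have "fst l $ k \<noteq> 0 \<or> fst l' $ k \<noteq> 0"
      using m(2) by (auto split: if_splits)
    then show ?thesis
      using resolvent(1,2) by (auto simp: constraint_vars_def pos_part_def neg_part_def)
  qed (use m(2) in \<open>auto simp: constraint_vars_def\<close>)
qed

lemma constraint_vars_Pi_iter:
  assumes "\<And>\<Psi>. \<Psi> \<in> \<C> \<Longrightarrow> constraint_vars \<Psi> \<subseteq> T" "\<Psi> \<in> Pi_iter s \<C> k"
  shows "constraint_vars \<Psi> \<subseteq> T"
  using assms(2)
proof (induction k arbitrary: \<Psi>)
  case 0
  then show ?case
    using assms(1) by (simp add: Pi_plus_def)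
next
  case (Suc k)
  then obtain \<Psi>1 \<Psi>2 where "\<Psi> = CPres s \<Psi>1 \<Psi>2" "\<Psi>1 \<in> Pi_iter s \<C> k" "\<Psi>2 \<in> \<C>"
    by (auto simp: Pi_pm_def)
  then show ?case
    using Suc.IH[of \<Psi>1] assms(1)[of \<Psi>2] constraint_vars_CPres[of s \<Psi>1 \<Psi>2] by blast
qed

lemma notin_constraint_vars_iff:
  "s \<notin> constraint_vars \<Psi> \<longleftrightarrow> pos_part s \<Psi> = {} \<and> neg_part s \<Psi> = {}"
  by (auto simp: constraint_vars_def pos_part_def neg_part_def neq_iff)

text \<open>In a final resolvent the first premise has no negative and the second no positive
  occurrence of \<open>s\<close>; resolving removes all others.\<close>

lemma constraint_vars_eliminate:
  assumes "\<And>\<Psi>. \<Psi> \<in> \<C> \<Longrightarrow> constraint_vars \<Psi> \<subseteq> T" "\<Psi> \<in> eliminate s \<C>"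
  shows "constraint_vars \<Psi> \<subseteq> T - {s}"
  using assms(2)
proof (cases rule: eliminate_cases)
  case kept
  then show ?thesis
    using assms(1)[of \<Psi>] notin_constraint_vars_iff[of s \<Psi>] by blast
next
  case (resolved \<Psi>1 \<Psi>2 k)
  have "s \<notin> constraint_vars \<Psi>"
    using resolved neg_part_Pi_iter[OF resolved(2)]
    by (simp add: notin_constraint_vars_iff neg_part_CPres pos_part_CPres)
  moreover have "constraint_vars \<Psi>1 \<subseteq> T"
    using constraint_vars_Pi_iter[OF assms(1) resolved(2)] .
  ultimately show ?thesis
    using resolved assms(1)[of \<Psi>2] constraint_vars_CPres[of s \<Psi>1 \<Psi>2] by blast
qed

section \<open>Iterated elimination along the ordering\<close>

lemma finite_elim_last: "finite \<C> \<Longrightarrow> finite (elim_last \<sigma> \<C> n)"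
  by (induction n) (auto intro: finite_eliminate)

lemma finite_mem_elim_last:
  assumes "\<And>\<Psi>. \<Psi> \<in> \<C> \<Longrightarrow> finite \<Psi>" "\<Psi> \<in> elim_last \<sigma> \<C> n"
  shows "finite \<Psi>"
  using assms(2)
  by (induction n arbitrary: \<Psi>) (auto intro: assms(1) finite_mem_eliminate)

lemma Omega_subset_elim_last: "Omega \<C> \<subseteq> Omega (elim_last \<sigma> \<C> n)"
  by (induction n) (use Omega_subset_eliminate in auto)

lemma constraint_vars_elim_last:
  fixes \<sigma> :: "nat \<Rightarrow> 'v::finite"
  assumes "variable_ordering \<sigma>" "\<Psi> \<in> elim_last \<sigma> \<C> n" "n \<le> CARD('v)"
  shows "constraint_vars \<Psi> \<subseteq> \<sigma> ` {1..CARD('v) - n}"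
  using assms(2,3)
proof (induction n arbitrary: \<Psi>)
  case 0
  then show ?case
    using assms(1) by (simp add: variable_ordering_def bij_betw_def)
next
  case (Suc n)
  \<comment> \<open>The index of the variable eliminated in step \<open>Suc n\<close>.\<close>
  define d where "d = CARD('v) - n"
  have d: "d \<ge> 1" "CARD('v) - Suc n = d - 1"
    using Suc.prems(2) by (simp_all add: d_def)
  have "{1..d} - {d} \<subseteq> {1..d - 1}"
    by auto
  then have "\<sigma> ` {1..d} - {\<sigma> d} \<subseteq> \<sigma> ` {1..d - 1}"
    by blast
  moreover have "constraint_vars \<Psi> \<subseteq> \<sigma> ` {1..d} - {\<sigma> d}"
    using Suc.prems Suc.IH unfolding d_def
    by (intro constraint_vars_eliminate[where \<C> = "elim_last \<sigma> \<C> n"]) auto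
  ultimately show ?case
    using d by auto
qed

section \<open>Feasible boundaries\<close>

text \<open>A finite nonempty supremum is attained; the empty one is minus infinity, which is below
  the real \<open>u\<close>.\<close>

lemma le_SUP_ereal_iff:
  assumes "finite A"
  shows "ereal u \<le> (SUP l\<in>A. ereal (f l)) \<longleftrightarrow> (\<exists>l\<in>A. u \<le> f l)"
  using assms by (induction A) (auto simp: sup_max le_max_iff_disj bot_ereal_def)

lemma INF_ereal_le_iff:
  assumes "finite A"
  shows "(INF l\<in>A. ereal (f l)) \<le> ereal u \<longleftrightarrow> (\<exists>l\<in>A. f l \<le> u)"
  using assms by (induction A) (auto simp: inf_min min_le_iff_disj top_ereal_def)

text \<open>A single-variable constraint forbids just the open interval between its boundaries, or
  nothing if a disjunct without the variable holds. At \<open>axis i u\<close> the other coordinates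
  are 0, so the boundaries are extremal roots at \<open>p = 0\<close>.\<close>

lemma satisfies_axis_iff:
  assumes "finite \<Psi>"
  shows "satisfies (axis i u) \<Psi> \<longleftrightarrow> ereal u \<le> left_bound i \<Psi> \<or> right_bound i \<Psi> \<le> ereal u
    \<or> (\<exists>l\<in>\<Psi>. fst l $ i = 0 \<and> snd l \<ge> 0)"
proof -
  have root: "- (snd l / fst l $ i) = lineq_root i 0 l" for l :: "'a lineq"
    by (simp add: lineq_root_def)
  have fin: "finite (neg_part i \<Psi>)" "finite (pos_part i \<Psi>)"
    using assms by (auto simp: neg_part_def pos_part_def)
  have L: "ereal u \<le> left_bound i \<Psi> \<longleftrightarrow> (\<exists>l\<in>\<Psi>. fst l $ i < 0 \<and> sat_lineq (axis i u) l)"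
    unfolding left_bound_def root le_SUP_ereal_iff[OF fin(1)]
    unfolding neg_part_def axis_eq_coord_upd
    using sat_lineq_coord_upd_neg[of _ i 0 u] by blast
  have R: "right_bound i \<Psi> \<le> ereal u \<longleftrightarrow> (\<exists>l\<in>\<Psi>. fst l $ i > 0 \<and> sat_lineq (axis i u) l)"
    unfolding right_bound_def root INF_ereal_le_iff[OF fin(2)]
    unfolding pos_part_def axis_eq_coord_upd
    using sat_lineq_coord_upd_pos[of _ i 0 u] by blast
  have Z: "sat_lineq (axis i u) l \<longleftrightarrow> snd l \<ge> 0" if "fst l $ i = 0" for l
    using that by (simp add: axis_eq_coord_upd sat_lineq_coord_upd_zero) (simp add: sat_lineq_def)
  show ?thesis
    unfolding L R satisfies_def using Z by (metis less_linear)
qed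

lemma feasible_iff: "ereal v \<in> feasible i \<C> \<longleftrightarrow> (\<forall>\<Psi>\<in>\<C>. satisfies (axis i v) \<Psi>)"
  by (auto simp: feasible_def Omega_def)

lemma feasible_left_bound:
  assumes finC: "finite \<C>" and fin: "\<And>\<Psi>. \<Psi> \<in> \<C> \<Longrightarrow> finite \<Psi>"
    and v: "ereal v \<in> feasible i \<C>" and t: "ereal t \<notin> feasible i \<C>" and "v < t"
  shows "\<exists>\<Psi>\<in>\<C>. left_bound i \<Psi> < ereal t \<and> left_bound i \<Psi> \<in> feasible i \<C>"
proof -
  define L where "L = {b \<in> left_bound i ` \<C>. ereal v \<le> b \<and> b < ereal t}"
  obtain \<Psi>0 where \<Psi>0: "\<Psi>0 \<in> \<C>" "\<not> satisfies (axis i t) \<Psi>0"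
    using t by (auto simp: feasible_iff)
  note iff = satisfies_axis_iff[OF fin[OF \<Psi>0(1)]]
  have lr: "left_bound i \<Psi>0 < ereal t" "ereal t < right_bound i \<Psi>0"
    using \<Psi>0(2) by (auto simp: iff not_le)
  have "ereal v < ereal t"
    using \<open>v < t\<close> by simp
  then have "\<not> right_bound i \<Psi>0 \<le> ereal v"
    using lr(2) by order
  \<comment> \<open>The constraint violated at \<open>t\<close> holds at \<open>v\<close>, which is
    possible only through its left boundary. This makes \<open>L\<close> nonempty.\<close>
  then have "ereal v \<le> left_bound i \<Psi>0"
    using v[unfolded feasible_iff, rule_format, OF \<Psi>0(1)] \<Psi>0(2) unfolding iff by blast
  then have L: "finite L" "L \<noteq> {}"
    using finC \<Psi>0(1) lr by (auto simp: L_def)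
  define m where "m = Min L"
  have mL: "m \<in> L"
    using Min_in[OF L] by (simp add: m_def)
  then obtain u where u: "m = ereal u"
    by (cases m) (auto simp: L_def)
  have "satisfies (axis i u) \<Psi>" if \<Psi>: "\<Psi> \<in> \<C>" for \<Psi>
  proof -
    have "satisfies (axis i v) \<Psi>"
      using v \<Psi> by (simp add: feasible_iff)
    moreover have "ereal v \<le> ereal u"
      using mL u by (simp add: L_def)
    \<comment> \<open>Moving right from \<open>v\<close> to \<open>u\<close> can only spoil left
      boundaries, but such a boundary is either in \<open>L\<close>, hence at least the minimum, or
      at least \<open>t\<close>.\<close>
    moreover have "ereal u \<le> left_bound i \<Psi>" if "ereal v \<le> left_bound i \<Psi>"
    proof (cases "left_bound i \<Psi> < ereal t")
      case True
      then show ?thesis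
        using that \<Psi> L(1) by (auto simp: L_def m_def simp flip: u)
    next
      case False
      moreover have "ereal u < ereal t"
        using mL u by (simp add: L_def)
      ultimately show ?thesis
        by order
    qed
    ultimately show ?thesis
      unfolding satisfies_axis_iff[OF fin[OF \<Psi>]] by (meson order_trans)
  qed
  then have "m \<in> feasible i \<C>"
    by (simp add: u feasible_iff)
  then show ?thesis
    using mL by (auto simp: L_def)
qed

text \<open>Mirror image of \<open>feasible_left_bound\<close>, with the greatest right boundary
  above \<open>t\<close> and at most \<open>v\<close>.\<close>

lemma feasible_right_bound:
  assumes finC: "finite \<C>" and fin: "\<And>\<Psi>. \<Psi> \<in> \<C> \<Longrightarrow> finite \<Psi>"
    and v: "ereal v \<in> feasible i \<C>" and t: "ereal t \<notin> feasible i \<C>" and "t < v"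
  shows "\<exists>\<Psi>\<in>\<C>. ereal t < right_bound i \<Psi> \<and> right_bound i \<Psi> \<in> feasible i \<C>"
proof -
  define R where "R = {b \<in> right_bound i ` \<C>. ereal t < b \<and> b \<le> ereal v}"
  obtain \<Psi>0 where \<Psi>0: "\<Psi>0 \<in> \<C>" "\<not> satisfies (axis i t) \<Psi>0"
    using t by (auto simp: feasible_iff)
  note iff = satisfies_axis_iff[OF fin[OF \<Psi>0(1)]]
  have lr: "left_bound i \<Psi>0 < ereal t" "ereal t < right_bound i \<Psi>0"
    using \<Psi>0(2) by (auto simp: iff not_le)
  have "ereal t < ereal v"
    using \<open>t < v\<close> by simp
  then have "\<not> ereal v \<le> left_bound i \<Psi>0"
    using lr(1) by order
  then have "right_bound i \<Psi>0 \<le> ereal v"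
    using v[unfolded feasible_iff, rule_format, OF \<Psi>0(1)] \<Psi>0(2) unfolding iff by blast
  then have R: "finite R" "R \<noteq> {}"
    using finC \<Psi>0(1) lr by (auto simp: R_def)
  define m where "m = Max R"
  have mR: "m \<in> R"
    using Max_in[OF R] by (simp add: m_def)
  then obtain u where u: "m = ereal u"
    by (cases m) (auto simp: R_def)
  have "satisfies (axis i u) \<Psi>" if \<Psi>: "\<Psi> \<in> \<C>" for \<Psi>
  proof -
    have "satisfies (axis i v) \<Psi>"
      using v \<Psi> by (simp add: feasible_iff)
    moreover have "ereal u \<le> ereal v"
      using mR u by (simp add: R_def)
    moreover have "right_bound i \<Psi> \<le> ereal u" if "right_bound i \<Psi> \<le> ereal v"
    proof (cases "ereal t < right_bound i \<Psi>")
      case True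
      then show ?thesis
        using that \<Psi> R(1) by (auto simp: R_def m_def simp flip: u)
    next
      case False
      moreover have "ereal t < ereal u"
        using mR u by (simp add: R_def)
      ultimately show ?thesis
        by order
    qed
    ultimately show ?thesis
      unfolding satisfies_axis_iff[OF fin[OF \<Psi>]] by (meson order_trans)
  qed
  then have "m \<in> feasible i \<C>"
    by (simp add: u feasible_iff)
  then show ?thesis
    using mR by (auto simp: R_def)
qed

text \<open>A finite nonempty supremum is attained, hence feasible. The infinite case retains that
  there was no candidate, to be refuted by \<open>feasible_left_bound\<close>.\<close>

lemma drl_left_cases:
  assumes "finite \<C>"
  shows "drl_left i \<C> t \<in> feasible i \<C> \<or> drl_left i \<C> t = -\<infinity>
    \<and> (\<forall>\<Psi>\<in>\<C>. left_bound i \<Psi> < ereal t \<longrightarrow> left_bound i \<Psi> \<notin> feasible i \<C>)"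
proof -
  define L where "L = {left_bound i \<Psi> | \<Psi>. \<Psi> \<in> \<C> \<and> ereal t > left_bound i \<Psi>
      \<and> left_bound i \<Psi> \<in> feasible i \<C>}"
  have "finite L"
    using assms by (simp add: L_def)
  have eq: "drl_left i \<C> t = Sup L"
    by (simp add: drl_left_def L_def)
  show ?thesis
  proof (cases "L = {}")
    case True
    have "Sup L = -\<infinity>"
      by (simp add: True bot_ereal_def)
    then show ?thesis
      using True unfolding eq by (auto simp: L_def)
  next
    case False
    then have "Sup L \<in> L"
      using \<open>finite L\<close> by (simp flip: Max_Sup)
    then show ?thesis
      unfolding eq by (auto simp: L_def)
  qed
qed

lemma drl_right_cases:
  assumes "finite \<C>"
  shows "drl_right i \<C> t \<in> feasible i \<C> \<or> drl_right i \<C> t = \<infinity>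
    \<and> (\<forall>\<Psi>\<in>\<C>. ereal t < right_bound i \<Psi> \<longrightarrow> right_bound i \<Psi> \<notin> feasible i \<C>)"
proof -
  define R where "R = {right_bound i \<Psi> | \<Psi>. \<Psi> \<in> \<C> \<and> ereal t < right_bound i \<Psi>
      \<and> right_bound i \<Psi> \<in> feasible i \<C>}"
  have "finite R"
    using assms by (simp add: R_def)
  have eq: "drl_right i \<C> t = Inf R"
    by (simp add: drl_right_def R_def)
  show ?thesis
  proof (cases "R = {}")
    case True
    have "Inf R = \<infinity>"
      by (simp add: True top_ereal_def)
    then show ?thesis
      using True unfolding eq by (auto simp: R_def)
  next
    case False
    then have "Inf R \<in> R"
      using \<open>finite R\<close> by (simp flip: Min_Inf)
    then show ?thesis
      unfolding eq by (auto simp: R_def)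
  qed
qed

lemma drl_value_feasible:
  assumes finC: "finite \<C>" and fin: "\<And>\<Psi>. \<Psi> \<in> \<C> \<Longrightarrow> finite \<Psi>"
    and v: "ereal v \<in> feasible i \<C>"
  shows "drl_value i \<C> t \<in> feasible i \<C>"
proof (cases "ereal t \<in> feasible i \<C>")
  case True
  then show ?thesis
    by (simp add: drl_value_def)
next
  case t: False
  let ?l = "drl_left i \<C> t" and ?r = "drl_right i \<C> t"
  have l: "?l \<in> feasible i \<C> \<or> ?l = -\<infinity>" and r: "?r \<in> feasible i \<C> \<or> ?r = \<infinity>"
    using drl_left_cases[OF finC] drl_right_cases[OF finC] by blast+
  have "v < t \<or> t < v"
    using v t by (metis less_linear)
  then have lr: "?l \<in> feasible i \<C> \<or> ?r \<in> feasible i \<C>"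
    using feasible_left_bound[OF finC fin v t] feasible_right_bound[OF finC fin v t]
      drl_left_cases[OF finC, of i t] drl_right_cases[OF finC, of i t] by blast
  have real: "\<exists>x. b = ereal x" if "b \<in> feasible i \<C>" for b
    using that by (auto simp: feasible_def)
  show ?thesis
  proof (cases "\<bar>ereal t - ?l\<bar> < \<bar>ereal t - ?r\<bar>")
    case True
    \<comment> \<open>An infinite distance is never strictly smaller.\<close>
    then have "?l \<noteq> -\<infinity>"
      by auto
    then show ?thesis
      using True t l by (simp add: drl_value_def)
  next
    case False
    \<comment> \<open>Otherwise the left candidate is feasible, hence real, and strictly
      closer.\<close>
    have "?r \<noteq> \<infinity>"
    proof
      assume inf: "?r = \<infinity>"
      then have "?l \<in> feasible i \<C>"
        using lr real by fastforce
      then show False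
        using False inf real by force
    qed
    then show ?thesis
      using False t r by (simp add: drl_value_def)
  qed
qed

section \<open>Correctness of the layer\<close>

text \<open>Apart from \<open>s\<close>, only variables of \<open>S\<close> occur in
  \<open>l\<close>, so the remainder at \<open>p\<close> is exactly the constant added by the
  substitution.\<close>

lemma sat_subst_lineq_iff:
  assumes "{k. fst l $ k \<noteq> 0} \<subseteq> insert s S" "s \<notin> S" "\<And>k. k \<in> S \<Longrightarrow> y k = p $ k"
  shows "sat_lineq (axis s v) (subst_lineq S y l) \<longleftrightarrow> sat_lineq (coord_upd s p v) l"
proof -
  have "fst (remainder s l) \<bullet> p = (\<Sum>k\<in>S. fst l $ k * p $ k)"
    unfolding inner_vec_def using assms(1,2)
    by (intro sum.mono_neutral_cong_right) auto
  also have "\<dots> = (\<Sum>k\<in>S. fst l $ k * y k)"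
    using assms(3) by simp
  finally show ?thesis
    using assms(2)
    unfolding sat_lineq_coord_upd by (simp add: sat_lineq_def subst_lineq_def inner_axis algebra_simps)
qed

lemma feasible_subst_iff:
  assumes "\<And>\<Psi>. \<Psi> \<in> \<C> \<Longrightarrow> constraint_vars \<Psi> \<subseteq> insert s S" "s \<notin> S" "\<And>k. k \<in> S \<Longrightarrow> y k = p $ k"
  shows "ereal v \<in> feasible s (subst_constraints S y \<C>) \<longleftrightarrow> coord_upd s p v \<in> Omega \<C>"
proof -
  have "sat_lineq (axis s v) (subst_lineq S y l) \<longleftrightarrow> sat_lineq (coord_upd s p v) l"
    if "\<Psi> \<in> \<C>" "l \<in> \<Psi>" for \<Psi> l
    using assms(1)[OF that(1)] that(2) assms(2,3)
    by (intro sat_subst_lineq_iff) (auto simp: constraint_vars_def)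
  then show ?thesis
    by (simp add: feasible_iff subst_constraints_def Omega_def satisfies_def)
qed

text \<open>The invariant: the values computed so far are real and are coordinates of a full
  solution \<open>p\<close> of stage \<open>i\<close>. Soundness of elimination gives stage 0,
  completeness each further stage.\<close>

lemma drl_upto_correct:
  fixes \<C> :: "'v::finite constraint set"
  assumes finC: "finite \<C>" and fin: "\<And>\<Psi>. \<Psi> \<in> \<C> \<Longrightarrow> finite \<Psi>"
    and sat: "satisfiable \<C>" and ord: "variable_ordering \<sigma>" and "i \<le> CARD('v)"
  shows "\<exists>p. p \<in> Omega (Pi_stage \<sigma> \<C> i) \<and> (\<forall>k\<in>\<sigma> ` {1..i}. drl_upto \<sigma> \<C> x i k = ereal (p $ k))"
  using \<open>i \<le> CARD('v)\<close>
proof (induction i)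
  case 0
  then show ?case
    using sat Omega_subset_elim_last[of \<C> \<sigma> "CARD('v)"]
    by (auto simp: satisfiable_def Pi_stage_def)
next
  case (Suc i)
  define s where "s = \<sigma> (Suc i)"
  define S where "S = \<sigma> ` {1..i}"
  define y where "y k = real_of_ereal (drl_upto \<sigma> \<C> x i k)" for k
  define \<D> where "\<D> = Pi_stage \<sigma> \<C> (Suc i)"
  define \<E> where "\<E> = subst_constraints S y \<D>"
  have image: "\<sigma> ` {1..Suc i} = insert s S"
    by (simp add: s_def S_def atLeastAtMostSuc_conv)
  have "s \<notin> S"
    using ord Suc.prems inj_on_image_mem_iff[of \<sigma> "{1..CARD('v)}" "Suc i" "{1..i}"]
    by (simp add: s_def S_def variable_ordering_def bij_betw_def)
  \<comment> \<open>Stages count from the front and \<open>elim_last\<close> from the back; these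
    identities show that going from stage \<open>Suc i\<close> to stage \<open>i\<close> eliminates
    \<open>s\<close>.\<close>
  have "CARD('v) - i = Suc (CARD('v) - Suc i)" "CARD('v) - (CARD('v) - Suc i) = Suc i"
    using Suc.prems by auto
  then have stage: "Pi_stage \<sigma> \<C> i = eliminate s \<D>"
    by (simp add: Pi_stage_def \<D>_def s_def)
  have finD: "finite \<D>" "\<And>\<Psi>. \<Psi> \<in> \<D> \<Longrightarrow> finite \<Psi>"
    using finite_elim_last[OF finC] finite_mem_elim_last[OF fin]
    unfolding \<D>_def Pi_stage_def by blast+
  then have finE: "finite \<E>" "\<And>\<Psi>. \<Psi> \<in> \<E> \<Longrightarrow> finite \<Psi>"
    by (auto simp: \<E>_def subst_constraints_def)
  have vars: "constraint_vars \<Psi> \<subseteq> insert s S" if "\<Psi> \<in> \<D>" for \<Psi>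
    using constraint_vars_elim_last[OF ord that[unfolded \<D>_def Pi_stage_def]] Suc.prems image
    by simp
  obtain p where p: "p \<in> Omega (eliminate s \<D>)" "\<And>k. k \<in> S \<Longrightarrow> drl_upto \<sigma> \<C> x i k = ereal (p $ k)"
    using Suc.IH Suc.prems stage by (auto simp: S_def)
  then have feasible: "ereal v \<in> feasible s \<E> \<longleftrightarrow> coord_upd s p v \<in> Omega \<D>" for v
    unfolding \<E>_def by (intro feasible_subst_iff vars \<open>s \<notin> S\<close>) (simp_all add: y_def)
  obtain v where "coord_upd s p v \<in> Omega \<D>"
    using eliminate_extends[OF finD p(1)] .
  then have val: "drl_value s \<E> (x $ s) \<in> feasible s \<E>"
    using drl_value_feasible[OF finE] feasible by simp
  then obtain u where u: "drl_value s \<E> (x $ s) = ereal u"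
    unfolding feasible_def by blast
  then have sol: "coord_upd s p u \<in> Omega \<D>"
    using val feasible by simp
  have "drl_upto \<sigma> \<C> x (Suc i) = (drl_upto \<sigma> \<C> x i)(s := ereal u)"
    unfolding u[symmetric] by (simp add: s_def S_def y_def[abs_def] \<D>_def \<E>_def)
  then have "drl_upto \<sigma> \<C> x (Suc i) k = ereal (coord_upd s p u $ k)" if "k \<in> insert s S" for k
    using that p(2) by auto
  then show ?case
    using sol unfolding image \<D>_def by blast
qed

theorem theorem3p5:
  fixes \<C> :: "'v::finite constraint set"
    and \<sigma> :: "nat \<Rightarrow> 'v"
    and x :: "real ^ 'v"
  assumes "finite \<C>"
    and "\<And>\<Psi>. \<Psi> \<in> \<C> \<Longrightarrow> finite \<Psi>"
    and "satisfiable \<C>"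
    and "variable_ordering \<sigma>"
  shows "\<exists>y. (\<forall>k. DRL \<sigma> \<C> x k = ereal (y $ k)) \<and> y \<in> Omega \<C>"
proof -
  \<comment> \<open>At the last stage all coordinates are computed and nothing has been
    eliminated.\<close>
  have "\<sigma> ` {1..CARD('v)} = UNIV"
    using assms(4) by (simp add: variable_ordering_def bij_betw_def)
  then show ?thesis
    using drl_upto_correct[OF assms order_refl, of x] by (auto simp: DRL_def Pi_stage_def)
qed

end
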